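(* Let $n\ge 3$ be an integer and let $W_n$ be the wheel graph with $n$ rim vertices. Then $\mathrm{mpd}(W_n)=\infty$.
   Context: The wheel graph $W_n$ is obtained from a cycle on $n$ vertices (the rim) by adding one new vertex (the hub) adjacent to all rim vertices. $d(u,v)$ denotes the shortest-path distance. Let $G$ be a connected graph and let $\Pi=\{S_1,\dots,S_t\}$ be a partition of $V(G)$ into nonempty parts. For $v\in V(G)$ put $d(v,S_i)=\min\{d(v,x):x\in S_i\}$. The multiset partition representation of $v$ with respect to $\Pi$ is the multiset $r_{mp}(v\mid\Pi)=\{d(v,S_1),\dots,d(v,S_t)\}$ (order ignored, multiplicities kept). $\Pi$ is a resolving multiset partition if $r_{mp}(u\mid\Pi)\ne r_{mp}(v\mid\Pi)$ for all distinct $u,v\in V(G)$. The multiset partition dimension $\mathrm{mpd}(G)$ is the minimum number $t$ of parts of a resolving multiset partition of $G$, and $\mathrm{mpd}(G)=\infty$ if none exists. *)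

theory Defs
  imports
    "Graph_Theory.Graph_Theory"
    "HOL-Library.Disjoint_Sets"
    "HOL-Library.Multiset"
    "HOL-Library.Extended_Nat"
begin

text \<open>
  Undirected simple graphs are modelled, as in \<^theory>\<open>Graph_Theory.Digraph\<close>, by finite symmetric
  loop-free digraphs without parallel arcs (locales \<^locale>\<open>graph\<close> and \<^locale>\<open>pair_graph\<close>).
\<close>

definition cycle_graph :: "nat \<Rightarrow> nat pair_pre_digraph" where
  "cycle_graph n =
    \<lparr> pverts = {..<n},
      parcs = {(i, j). i < n \<and> j < n \<and> (j = Suc i mod n \<or> i = Suc j mod n)} \<rparr>"

text \<open>The hub is \<^term>\<open>None\<close>; the rim is the copy of the cycle under \<^term>\<open>Some\<close>.\<close>

definition wheel_graph :: "nat \<Rightarrow> nat option pair_pre_digraph" where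
  "wheel_graph n =
    (let C = cycle_graph n in
      \<lparr> pverts = insert None (Some ` pverts C),
        parcs = map_prod Some Some ` parcs C
          \<union> {None} \<times> Some ` pverts C \<union> Some ` pverts C \<times> {None} \<rparr>)"

text \<open>
  The shortest-path distance is the library's minimal walk cost for unit arc weights. It takes
  values in \<^typ>\<open>ereal\<close>, and equals \<open>\<infinity>\<close> exactly for vertices not joined by a walk.
\<close>

definition gdist :: "('a, 'b) pre_digraph \<Rightarrow> 'a \<Rightarrow> 'a \<Rightarrow> ereal" where
  "gdist G u v = wf_digraph.\<mu> G (\<lambda>_. 1) u v"

text \<open>\<^const>\<open>Min\<close> and \<^const>\<open>mset_set\<close> are meaningful for finite sets only; here they are applied
  to the parts of a partition of a finite vertex set, and to the partition itself.\<close>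

definition set_dist :: "('a, 'b) pre_digraph \<Rightarrow> 'a \<Rightarrow> 'a set \<Rightarrow> ereal" where
  "set_dist G v S = Min (gdist G v ` S)"

definition mp_repr :: "('a, 'b) pre_digraph \<Rightarrow> 'a set set \<Rightarrow> 'a \<Rightarrow> ereal multiset" where
  "mp_repr G P v = image_mset (set_dist G v) (mset_set P)"

definition resolving_mp :: "('a, 'b) pre_digraph \<Rightarrow> 'a set set \<Rightarrow> bool" where
  "resolving_mp G P \<longleftrightarrow>
    partition_on (verts G) P \<and>
    (\<forall>u \<in> verts G. \<forall>v \<in> verts G. u \<noteq> v \<longrightarrow> mp_repr G P u \<noteq> mp_repr G P v)"

text \<open>In \<^typ>\<open>enat\<close> the infimum of the empty set is \<open>\<infinity>\<close>, and any other infimum is attained.\<close>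

definition mpd :: "('a, 'b) pre_digraph \<Rightarrow> enat" where
  "mpd G = (INF P \<in> {P. resolving_mp G P}. enat (card P))"

lemma pair_graph_wheel_graph:
  assumes "n \<ge> 3"
  shows "pair_graph (wheel_graph n)"
proof -
  have noloop: "Suc i mod n \<noteq> i" if "i < n" for i
    using that assms by (cases "Suc i = n") auto
  have fin: "finite (parcs (cycle_graph n))"
    by (rule finite_subset[of _ "{..<n} \<times> {..<n}"]) (auto simp: cycle_graph_def)
  show ?thesis
  proof
    show "finite (parcs (wheel_graph n))"
      using fin by (simp add: wheel_graph_def Let_def) (simp add: cycle_graph_def)
    show "symmetric (wheel_graph n)"
      by (auto simp: symmetric_def sym_def wheel_graph_def cycle_graph_def Let_def)
    show "fst e \<noteq> snd e" if "e \<in> parcs (wheel_graph n)" for e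
      using that noloop by (auto simp: wheel_graph_def cycle_graph_def Let_def) metis+
  qed (auto simp: wheel_graph_def cycle_graph_def Let_def)
qed

lemma connected_wheel_graph:
  assumes "n \<ge> 3"
  shows "connected (with_proj (wheel_graph n))"
proof -
  interpret pair_graph "wheel_graph n" using assms by (rule pair_graph_wheel_graph)
  have hub: "None \<rightarrow>\<^sup>*\<^bsub>with_proj (wheel_graph n)\<^esub> v" if "v \<in> pverts (wheel_graph n)" for v
  proof (cases "v = None")
    case True
    then show ?thesis using that by (simp add: reachable_refl)
  next
    case False
    then have "(None, v) \<in> parcs (wheel_graph n)"
      using that by (auto simp: wheel_graph_def cycle_graph_def Let_def)
    then show ?thesis by (intro reachable_adjI) simp
  qed
  have "strongly_connected (with_proj (wheel_graph n))"
  proof (rule strongly_connectedI)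
    show "verts (with_proj (wheel_graph n)) \<noteq> {}" by (simp add: wheel_graph_def Let_def)
    fix u v
    assume "u \<in> verts (with_proj (wheel_graph n))" "v \<in> verts (with_proj (wheel_graph n))"
    then show "u \<rightarrow>\<^sup>*\<^bsub>with_proj (wheel_graph n)\<^esub> v"
      using hub symmetric_reachable' reachable_trans by (metis with_proj_simps(1))
  qed
  then show ?thesis
    unfolding connected_def strongly_connected_def
    using reachable_mk_symmetric_eq[OF sym_arcs] by simp
qed

end

theory Submission
  imports Defs
begin

text \<open>
  In a graph of diameter at most two, the representation of \<open>v\<close> consists of one \<open>0\<close> and of ones and
  twos, so it is determined by the number of parts other than that of \<open>v\<close> which meet the
  neighbourhood of \<open>v\<close>. A rim vertex of a wheel has three neighbours, so this number lies in
  \<open>{0, 1, 2, 3}\<close>, and five rim vertices cannot be told apart. For \<open>n = 4\<close> all four values would have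
  to occur. But \<open>0\<close> at \<open>i\<close> puts the hub and three of the rim vertices in one part, while \<open>3\<close> at \<open>j\<close>
  puts \<open>j\<close> and its neighbours in four different parts. For \<open>n = 3\<close> the wheel is complete.
\<close>

section \<open>Distances 0, 1 and 2 in terms of adjacency\<close>

context wf_digraph
begin

text \<open>Turns lower bounds on \<open>gdist\<close> into lower bounds on the length of a
  walk.\<close>

lemma awalk_cost_one: "awalk_cost (\<lambda>_. 1) p = real (length p)"
  by (induction p) auto

lemma gdist_self:
  assumes "u \<in> verts G"
  shows "gdist G u u = 0"
proof (rule antisym)
  have "awalk u [] u" using assms by (simp add: awalk_Nil_iff)
  from min_cost_le_walk_cost[OF this, of "\<lambda>_. 1"] show "gdist G u u \<le> 0"
    unfolding gdist_def by (simp add: zero_ereal_def)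
  show "0 \<le> gdist G u u"
    unfolding gdist_def \<mu>_def by (rule INF_greatest) (simp add: awalk_cost_one)
qed

lemma gdist_adj:
  assumes "u \<rightarrow> v" "u \<noteq> v"
  shows "gdist G u v = 1"
proof (rule antisym)
  obtain e where "awalk u [e] v"
    using assms(1) by (auto simp: arcs_ends_conv intro: arc_implies_awalk)
  from min_cost_le_walk_cost[OF this, of "\<lambda>_. 1"] show "gdist G u v \<le> 1"
    unfolding gdist_def by (simp add: one_ereal_def)
  have "length p \<ge> 1" if "awalk u p v" for p
    using that assms(2) by (cases p) (auto simp: awalk_Nil_iff)
  then show "1 \<le> gdist G u v"
    unfolding gdist_def \<mu>_def by (intro INF_greatest) (auto simp: awalk_cost_one)
qed

lemma gdist_two:
  assumes "u \<rightarrow> w" "w \<rightarrow> v" "u \<noteq> v" "\<not> u \<rightarrow> v"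
  shows "gdist G u v = 2"
proof (rule antisym)
  obtain e where "awalk u [e] w"
    using assms(1) by (auto simp: arcs_ends_conv intro: arc_implies_awalk)
  moreover obtain f where "awalk w [f] v"
    using assms(2) by (auto simp: arcs_ends_conv intro: arc_implies_awalk)
  ultimately have "awalk u [e, f] v" by (auto dest: awalk_appendI)
  from min_cost_le_walk_cost[OF this, of "\<lambda>_. 1"] show "gdist G u v \<le> 2"
    unfolding gdist_def by simp
  \<comment> \<open>A shorter walk is empty, forcing \<open>u = v\<close>, or a single arc, forcing
    adjacency.\<close>
  have "length p \<ge> 2" if "awalk u p v" for p
  proof (rule ccontr)
    assume "\<not> length p \<ge> 2"
    then consider "p = []" | e where "p = [e]"
      by (cases p rule: list.exhaust[case_product list.exhaust]; cases "tl p") auto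
    then show False
      using that assms(3,4)
      by cases (auto simp: awalk_Nil_iff awalk_Cons_iff in_arcs_imp_in_arcs_ends)
  qed
  then show "2 \<le> gdist G u v"
    unfolding gdist_def \<mu>_def by (intro INF_greatest) (auto simp: awalk_cost_one)
qed

end

text \<open>Replaces a partition by its class map, so that the parts meeting a set \<open>X\<close>
  of vertices become the image of \<open>X\<close> under \<open>p\<close>.\<close>

lemma partition_on_classE:
  assumes "partition_on A P"
  obtains p where "P = p ` A" "\<And>x y. x \<in> A \<Longrightarrow> y \<in> p x \<longleftrightarrow> y \<in> A \<and> p y = p x"
proof
  define p where "p x = (THE S. S \<in> P \<and> x \<in> S)" for x
  have p: "p x = S" if "S \<in> P" "x \<in> S" for x S
    unfolding p_def
    by (rule the_equality) (use that partition_onD2[OF assms] in \<open>auto simp: disjoint_def\<close>)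
  have A: "x \<in> A \<longleftrightarrow> (\<exists>S\<in>P. x \<in> S)" for x
    using partition_onD1[OF assms] by auto
  show "P = p ` A"
  proof (intro set_eqI iffI)
    fix S assume "S \<in> P"
    then obtain x where "x \<in> S" using partition_onD3[OF assms] by fastforce
    then show "S \<in> p ` A" using p A \<open>S \<in> P\<close> by blast
  qed (use p A in auto)
  show "y \<in> p x \<longleftrightarrow> y \<in> A \<and> p y = p x" if "x \<in> A" for x y
    using that p A by metis
qed

section \<open>Representations in graphs of diameter at most two\<close>

locale diameter_two_graph = fin_digraph +
  assumes diameter: "u \<in> verts G \<Longrightarrow> v \<in> verts G \<Longrightarrow> u = v \<or> u \<rightarrow> v \<or> (\<exists>w. u \<rightarrow> w \<and> w \<rightarrow> v)"
begin

lemma set_dist_eq: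
  assumes "v \<in> verts G" "S \<subseteq> verts G" "S \<noteq> {}"
  shows "set_dist G v S = (if v \<in> S then 0 else if \<exists>x\<in>S. v \<rightarrow> x then 1 else 2)"
proof -
  have gdist: "gdist G v x = (if v = x then 0 else if v \<rightarrow> x then 1 else 2)" if "x \<in> S" for x
  proof -
    have "x \<in> verts G" using that assms(2) by blast
    then show ?thesis
      using assms(1) diameter[of v x] gdist_self gdist_adj[of v x] gdist_two[of v _ x] by auto
  qed
  have "finite S" using assms(2) finite_verts finite_subset by blast
  then show ?thesis
    unfolding set_dist_def
    by (intro Min_eqI) (use assms(3) in \<open>auto simp: gdist image_iff split: if_splits\<close>)
qed

text \<open>The part of \<open>v\<close> contributes the 0, each of the \<open>k\<close> other parts
  that meet its neighbourhood a 1, and every remaining part a 2. As the number of parts is fixed,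
  the multiset depends on \<open>k\<close> alone.\<close>

lemma mp_repr_eq:
  fixes p :: "'a \<Rightarrow> 'a set"
  assumes p: "\<And>x y. x \<in> verts G \<Longrightarrow> y \<in> p x \<longleftrightarrow> y \<in> verts G \<and> p y = p x" and v: "v \<in> verts G"
  defines "k \<equiv> card (p ` {x. v \<rightarrow> x} - {p v})"
  shows "mp_repr G (p ` verts G) v =
    {#0#} + replicate_mset k 1 + replicate_mset (card (p ` verts G) - 1 - k) 2"
proof -
  let ?P = "p ` verts G" and ?U = "p ` {x. v \<rightarrow> x} - {p v}"
  let ?R = "?P - {p v} - ?U"
  have U: "?U \<subseteq> ?P - {p v}" by (auto dest: adj_in_verts)
  have finP: "finite ?P" by simp
  have finU: "finite ?U" using U finP by (meson finite_Diff finite_subset)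
  \<comment> \<open>The three disjoint pieces are the parts at distance 0, 1 and 2 from
    \<open>v\<close>.\<close>
  have split: "?P = insert (p v) (?U \<union> ?R)" using U v by auto
  have "mset_set ?P = add_mset (p v) (mset_set (?U \<union> ?R))"
    by (subst split, rule mset_set.insert) (use finU finP in auto)
  also have "mset_set (?U \<union> ?R) = mset_set ?U + mset_set ?R"
    by (rule mset_set_Union) (use finU finP in auto)
  finally have mset: "mset_set ?P = add_mset (p v) (mset_set ?U + mset_set ?R)" .
  have dist: "set_dist G v (p y) = (if p v = p y then 0 else if \<exists>x. v \<rightarrow> x \<and> p x = p y then 1 else 2)"
    if "y \<in> verts G" for y
  proof -
    have "p y \<subseteq> verts G" "p y \<noteq> {}" using p[OF that] that by auto
    from set_dist_eq[OF v this] show ?thesis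
      using p[OF that] v by (auto dest: adj_in_verts)
  qed
  have "image_mset (set_dist G v) (mset_set ?U) = image_mset (\<lambda>_. 1) (mset_set ?U)"
  proof (rule image_mset_cong)
    fix S assume "S \<in># mset_set ?U"
    then obtain x where x: "v \<rightarrow> x" "S = p x" "p x \<noteq> p v" using finU by auto
    then have "set_dist G v (p x) = (if p v = p x then 0 else if \<exists>y. v \<rightarrow> y \<and> p y = p x then 1 else 2)"
      by (intro dist) (auto dest: adj_in_verts)
    then show "set_dist G v S = 1" using x by auto
  qed
  moreover have "image_mset (set_dist G v) (mset_set ?R) = image_mset (\<lambda>_. 2) (mset_set ?R)"
  proof (rule image_mset_cong)
    fix S assume "S \<in># mset_set ?R"
    then have S: "S \<in> ?P" "S \<noteq> p v" "S \<notin> p ` {x. v \<rightarrow> x}" by auto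
    then obtain x where x: "x \<in> verts G" "S = p x" by blast
    with S have "p v \<noteq> p x" "\<not> (\<exists>y. v \<rightarrow> y \<and> p y = p x)" by (metis, blast)
    with x(2) dist[OF x(1)] show "set_dist G v S = 2" by simp
  qed
  moreover have "card ?R = card ?P - 1 - k"
    unfolding k_def using U v finU by (simp add: card_Diff_subset)
  ultimately show ?thesis
    unfolding mp_repr_def mset using v
    by (simp add: image_mset_const_eq k_def dist)
qed

lemma resolving_mpE:
  assumes "resolving_mp G P"
  obtains p :: "'a \<Rightarrow> 'a set"
    where "inj_on (\<lambda>v. card (p ` {x. v \<rightarrow> x} - {p v})) (verts G)"
proof -
  obtain p where p: "P = p ` verts G"
    "\<And>x y. x \<in> verts G \<Longrightarrow> y \<in> p x \<longleftrightarrow> y \<in> verts G \<and> p y = p x"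
    using assms unfolding resolving_mp_def by (metis partition_on_classE)
  have "inj_on (\<lambda>v. card (p ` {x. v \<rightarrow> x} - {p v})) (verts G)"
  proof (rule inj_onI, rule ccontr)
    fix u v assume uv: "u \<in> verts G" "v \<in> verts G" "u \<noteq> v"
      and "card (p ` {x. u \<rightarrow> x} - {p u}) = card (p ` {x. v \<rightarrow> x} - {p v})"
    then have "mp_repr G P u = mp_repr G P v"
      using mp_repr_eq[of p, OF p(2)] p(1) by simp
    then show False using assms uv unfolding resolving_mp_def by blast
  qed
  with that show thesis by blast
qed

end

section \<open>Adjacency in the wheel\<close>

lemma pverts_wheel_graph: "pverts (wheel_graph n) = insert None (Some ` {..<n})"
  by (simp add: wheel_graph_def cycle_graph_def)

lemma parcs_wheel_graph:
  "(None, None) \<notin> parcs (wheel_graph n)"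
  "(None, Some j) \<in> parcs (wheel_graph n) \<longleftrightarrow> j < n"
  "(Some i, None) \<in> parcs (wheel_graph n) \<longleftrightarrow> i < n"
  "(Some i, Some j) \<in> parcs (wheel_graph n) \<longleftrightarrow>
    i < n \<and> j < n \<and> (j = Suc i mod n \<or> i = Suc j mod n)"
  by (auto simp: wheel_graph_def cycle_graph_def)

lemma diameter_two_wheel_graph:
  assumes "n \<ge> 3"
  shows "diameter_two_graph (with_proj (wheel_graph n))"
proof -
  interpret pair_graph "wheel_graph n" using assms by (rule pair_graph_wheel_graph)
  show ?thesis
  proof
    fix u v
    assume "u \<in> verts (with_proj (wheel_graph n))" "v \<in> verts (with_proj (wheel_graph n))"
    \<comment> \<open>Two rim vertices have the hub \<open>None\<close> as a common neighbour; the
      hub is adjacent to the whole rim.\<close>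
    then show "u = v \<or> u \<rightarrow>\<^bsub>with_proj (wheel_graph n)\<^esub> v \<or>
      (\<exists>w. u \<rightarrow>\<^bsub>with_proj (wheel_graph n)\<^esub> w \<and> w \<rightarrow>\<^bsub>with_proj (wheel_graph n)\<^esub> v)"
      by (cases u; cases v)
        (auto simp: pverts_wheel_graph parcs_wheel_graph intro!: exI[of _ None])
  qed
qed

text \<open>Solves for the rim predecessor of \<open>i\<close>. Adding \<open>n\<close> before
  subtracting 1 makes \<open>i = 0\<close> wrap around to \<open>n - 1\<close> instead of being
  truncated.\<close>

lemma Suc_mod_eq_iff:
  assumes "i < n" "j < n"
  shows "i = Suc j mod n \<longleftrightarrow> j = (i + n - 1) mod n"
  using assms by (cases "Suc j = n"; cases i) (auto simp: mod_if)

lemma rim_neighbours: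
  assumes "i < n"
  shows "{x. Some i \<rightarrow>\<^bsub>with_proj (wheel_graph n)\<^esub> x} =
    {None, Some (Suc i mod n), Some ((i + n - 1) mod n)}"
proof -
  have "Some i \<rightarrow>\<^bsub>with_proj (wheel_graph n)\<^esub> Some j \<longleftrightarrow>
    j = Suc i mod n \<or> j = (i + n - 1) mod n" for j
    using assms Suc_mod_eq_iff[of i n j] by (cases "j < n") (auto simp: parcs_wheel_graph)
  moreover have "Some i \<rightarrow>\<^bsub>with_proj (wheel_graph n)\<^esub> None"
    using assms by (simp add: parcs_wheel_graph)
  ultimately have "Some i \<rightarrow>\<^bsub>with_proj (wheel_graph n)\<^esub> x \<longleftrightarrow>
    x \<in> {None, Some (Suc i mod n), Some ((i + n - 1) mod n)}" for x
    by (cases x) simp_all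
  then show ?thesis by blast
qed

text \<open>The right-hand side is symmetric in the four values, so vertices with the same closed
  neighbourhood get equal counts.\<close>

lemma card_Diff_fourth: "card ({a, b, c} - {d}) = card {a, b, c, d} - 1"
proof -
  have "{a, b, c} - {d} = {a, b, c, d} - {d}" by auto
  then show ?thesis by (simp add: card_Diff_singleton)
qed

text \<open>If \<open>a\<close> is \<open>d\<close>, \<open>b\<close> or \<open>c\<close>, then
  \<open>b\<close> and \<open>c\<close> alone cover the difference. With the part of the hub as
  \<open>a\<close>, a count of 3 separates the hub from a rim vertex and both its rim
  neighbours.\<close>

lemma card_Diff_le_2:
  assumes "a \<in> {d, b, c}"
  shows "card ({a, b, c} - {d}) \<le> 2"
proof -
  have "{a, b, c} - {d} \<subseteq> set [b, c]" using assms by auto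
  then have "card ({a, b, c} - {d}) \<le> card (set [b, c])" by (intro card_mono) simp_all
  also have "\<dots> \<le> 2" using card_length[of "[b, c]"] by simp
  finally show ?thesis .
qed

lemma not_resolving_wheel:
  assumes n: "n \<ge> 3"
  shows "\<not> resolving_mp (with_proj (wheel_graph n)) P"
proof
  assume res: "resolving_mp (with_proj (wheel_graph n)) P"
  interpret diameter_two_graph "with_proj (wheel_graph n)"
    using n by (rule diameter_two_wheel_graph)
  obtain p :: "nat option \<Rightarrow> nat option set" where inj:
    "inj_on (\<lambda>v. card (p ` {x. v \<rightarrow>\<^bsub>with_proj (wheel_graph n)\<^esub> x} - {p v}))
      (verts (with_proj (wheel_graph n)))"
    using resolving_mpE[OF res] .
  define f where
    "f i = card (p ` {None, Some (Suc i mod n), Some ((i + n - 1) mod n)} - {p (Some i)})" for i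
  have inj_f: "inj_on f {..<n}"
  proof (rule inj_onI)
    fix i j assume "i \<in> {..<n}" "j \<in> {..<n}" "f i = f j"
    then show "i = j"
      using inj_onD[OF inj, of "Some i" "Some j"] rim_neighbours[of i n] rim_neighbours[of j n]
      by (simp add: f_def pverts_wheel_graph)
  qed
  have f_le: "f i \<le> 3" for i
  proof -
    have "f i \<le> card (p ` {None, Some (Suc i mod n), Some ((i + n - 1) mod n)})"
      unfolding f_def by (rule card_Diff1_le)
    also have "\<dots> \<le> card {None, Some (Suc i mod n), Some ((i + n - 1) mod n)}"
      by (rule card_image_le) simp
    also have "\<dots> \<le> 3"
      using card_length[of "[None, Some (Suc i mod n), Some ((i + n - 1) mod n)]"] by simp
    finally show ?thesis .
  qed
  \<comment> \<open>Pigeonhole: \<open>f\<close> maps the \<open>n\<close> rim vertices injectively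
    into the four values 0 to 3.\<close>
  have "n \<le> 4"
    using card_inj_on_le[OF inj_f, of "{..3}"] f_le by auto
  with n consider "n = 3" | "n = 4" by linarith
  then show False
  proof cases
    case 1
    \<comment> \<open>The two rim neighbours are now all the other rim vertices, so the closed
      neighbourhoods of 0 and 1 both contain every vertex.\<close>
    have "f 0 = card {p None, p (Some 1), p (Some 2), p (Some 0)} - 1"
      unfolding f_def 1 by (simp add: card_Diff_fourth)
    moreover have "f 1 = card {p None, p (Some 2), p (Some 0), p (Some 1)} - 1"
      unfolding f_def 1 by (simp add: card_Diff_fourth numeral_2_eq_2)
    ultimately have "f 0 = f 1" by (simp add: insert_commute)
    then show False using inj_onD[OF inj_f, of 0 1] 1 by simp
  next
    case 2
    \<comment> \<open>An injection between sets of size four is onto, so the extreme counts 0 and 3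
      both occur.\<close>
    have "f ` {..<n} = {..3}"
      by (rule card_subset_eq) (use f_le card_image[OF inj_f] 2 in auto)
    then have "0 \<in> f ` {..<n}" "3 \<in> f ` {..<n}" by auto
    then obtain i j where ij: "i < 4" "f i = 0" "j < 4" "f j = 3" using 2 by auto
    have f: "f m = card (p ` {None, Some (Suc m mod 4), Some ((m + 3) mod 4)} - {p (Some m)})" for m
      unfolding f_def 2 by (simp add: add.commute)
    from ij(2) f[of i] have "p ` {None, Some (Suc i mod 4), Some ((i + 3) mod 4)} - {p (Some i)} = {}"
      by (metis card_0_eq finite.emptyI finite_Diff finite_imageI finite_insert)
    then have "p ` {None, Some (Suc i mod 4), Some ((i + 3) mod 4)} \<subseteq> {p (Some i)}"
      by (rule iffD1[OF Diff_eq_empty_iff])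
    then have i: "p None = p (Some i)" "p (Some (Suc i mod 4)) = p (Some i)"
        "p (Some ((i + 3) mod 4)) = p (Some i)"
      by simp_all
    have j: "p None \<notin> {p (Some j), p (Some (Suc j mod 4)), p (Some ((j + 3) mod 4))}"
    proof
      assume "p None \<in> {p (Some j), p (Some (Suc j mod 4)), p (Some ((j + 3) mod 4))}"
      from card_Diff_le_2[OF this] ij(4) f[of j] show False
        unfolding image_insert image_empty by linarith
    qed
    have "i \<in> {0, 1, 2, 3}" "j \<in> {0, 1, 2, 3}" using ij(1,3) by auto
    \<comment> \<open>Two sets of three rim vertices out of four must meet; the sixteen pairs are
      checked directly. A common vertex \<open>k\<close> shares the part of the hub by the choice of
      \<open>i\<close>, but not by the choice of \<open>j\<close>.\<close>
    then have "\<exists>k \<in> {i, Suc i mod 4, (i + 3) mod 4}. k \<in> {j, Suc j mod 4, (j + 3) mod 4}"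
      by (elim insertE emptyE) auto
    then obtain k where k: "k \<in> {i, Suc i mod 4, (i + 3) mod 4}"
        "k \<in> {j, Suc j mod 4, (j + 3) mod 4}"
      by blast
    have "p None = p (Some k)" using k(1) i by (elim insertE emptyE) simp_all
    moreover have "p None \<noteq> p (Some k)" using k(2) j by (elim insertE emptyE) simp_all
    ultimately show False by contradiction
  qed
qed

theorem theorem4p2:
  fixes n :: nat
  assumes "n \<ge> 3"
  shows "mpd (with_proj (wheel_graph n)) = \<infinity>"
  \<comment> \<open>The infimum ranges over the empty set, hence is the top element of
    \<open>enat\<close>.\<close>
  using not_resolving_wheel[OF assms] by (simp add: mpd_def top_enat_def)

end
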